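(* Let $p$ be a prime and let $f(x)=\sum_{m=0}^{\infty}B_m\chi(m,x):\mathbb{Z}_p\to\mathbb{Z}_p$ be a measure-preserving 1-Lipschitz function in van der Put expansion. For $n\ge2$ and $p^{n-1}\le m\le p^n-1$ write $B_m=p^{n-1}b_m$ with $b_m=b_{m0}+b_{m1}p+\cdots$ ($0\le b_{mi}\le p-1$, $b_{m0}\ne0$) and set $T_n=\sum_{m=p^{n-1}}^{p^n-1}b_{m1}$. For $m\ge0$ write $f(m)=\sum_{i\ge0}f_{mi}p^i$ with $0\le f_{mi}\le p-1$, and for $n\ge1$ set $S_n=\sum_{m=0}^{p^n-1}f_{mn}$. Let $r$ be an integer. Then: (1) Case $n=2$. (a) If $p=2$: $\sum_{m=2}^{3}B_m\equiv4\pmod{2^3}\iff\sum_{m=2}^{3}b_m\equiv2\pmod{2^2}\iff S_2\equiv S_1\pmod2\iff T_2\equiv0\pmod2$; and $\sum_{m=2}^{3}B_m\equiv0\pmod{2^3}\iff\sum_{m=2}^{3}b_m\equiv0\pmod{2^2}\iff S_2\equiv S_1+1\pmod2\iff T_2\equiv1\pmod2$. (b) If $p>2$: $\sum_{m=p}^{p^2-1}B_m\equiv rp^2\pmod{p^3}\iff\sum_{m=p}^{p^2-1}b_m\equiv rp\pmod{p^2}\iff S_2\equiv S_1+r\pmod p\iff T_2\equiv r\pmod p$. (2) For $n\ge3$ and any prime $p$: $\sum_{m=p^{n-1}}^{p^n-1}B_m\equiv rp^n\pmod{p^{n+1}}\iff\sum_{m=p^{n-1}}^{p^n-1}b_m\equiv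 rp\pmod{p^2}\iff S_n\equiv S_{n-1}+r\pmod p\iff T_n\equiv r\pmod p$.
   Context: $\mathbb{Z}_p$ is the ring of $p$-adic integers with absolute value $|x|_p=p^{-\mathrm{ord}(x)}$ and normalized Haar measure $\mu_p$. A function $f:\mathbb{Z}_p\to\mathbb{Z}_p$ is 1-Lipschitz if $|f(x)-f(y)|_p\le|x-y|_p$ for all $x,y$; measure-preserving if $\mu_p(f^{-1}(S))=\mu_p(S)$ for every measurable $S$. For an integer $m>0$ with base-$p$ expansion $m=m_0+m_1p+\dots+m_sp^s$ ($0\le m_i\le p-1$, $m_s\ne0$), put $q(m)=m_sp^s$. The van der Put basis is: for $m>0$, $\chi(m,x)=1$ if $|x-m|_p\le p^{-\lfloor\log_p m\rfloor-1}$ and $0$ otherwise; $\chi(0,x)=1$ if $|x|_p\le p^{-1}$ and $0$ otherwise. Every continuous $f:\mathbb{Z}_p\to\mathbb{Z}_p$ has a unique expansion $f(x)=\sum_{m\ge0}B_m\chi(m,x)$ with $B_m\in\mathbb{Z}_p$, where $B_m=f(m)$ for $0\le m\le p-1$ and $B_m=f(m)-f(m-q(m))$ for $m\ge p$. For measure-preserving 1-Lipschitz $f$, $|B_m|_p=p^{-(n-1)}$ when $p^{n-1}\le m\le p^n-1$, so $b_m$ is a unit. *)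

theory Defs
  imports
    "HOL-Probability.Probability"
    "Berlekamp_Zassenhaus.Finite_Field"
begin

section \<open>The ring of p-adic integers\<close>

text \<open>
  The prime \<open>p\<close> is the cardinality of the type parameter \<open>'p :: prime_card\<close>, and
  \<open>'p padic_int\<close> is the inverse limit of the rings of integers modulo \<open>p ^ n\<close>: an element is
  the sequence of its least nonnegative residues modulo \<open>p ^ n\<close>.
\<close>

typedef 'p padic_int = "{x :: nat \<Rightarrow> int. \<forall>n. x n = x (Suc n) mod int CARD('p) ^ n}"
  morphisms padic_residue Abs_padic_int
  by (rule exI[of _ "\<lambda>_. 0"]) simp

setup_lifting type_definition_padic_int

lemma CARD_prime_card_gt_1: "1 < CARD('p :: prime_card)"
  using prime_card[where 'a = 'p] prime_gt_1_nat by blast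

lemma CARD_prime_card_pos: "0 < CARD('p :: prime_card)"
  using CARD_prime_card_gt_1[where 'p = 'p] by simp

lemma padic_int_eqI: "(\<And>n. padic_residue x n = padic_residue y n) \<Longrightarrow> x = y"
  by (metis ext padic_residue_inject)

lemma padic_residue_Suc_mod:
  "padic_residue (x :: 'p padic_int) (Suc n) mod int CARD('p) ^ n = padic_residue x n"
  using padic_residue[of x] by (metis (mono_tags, lifting) mem_Collect_eq)

lemma padic_residue_mod_self:
  "padic_residue (x :: 'p padic_int) n mod int CARD('p) ^ n = padic_residue x n"
  by (metis padic_residue_Suc_mod mod_mod_trivial)

lemma padic_residue_mod:
  "m \<le> n \<Longrightarrow> padic_residue (x :: 'p padic_int) n mod int CARD('p) ^ m = padic_residue x m"
proof (induction n rule: dec_induct)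
  case base
  show ?case by (rule padic_residue_mod_self)
next
  case (step n)
  have "padic_residue x (Suc n) mod int CARD('p) ^ m
      = padic_residue x (Suc n) mod int CARD('p) ^ n mod int CARD('p) ^ m"
    using step.hyps by (simp add: mod_mod_cancel le_imp_power_dvd)
  then show ?case using step.IH by (simp add: padic_residue_Suc_mod)
qed

lemma padic_residue_nonneg: "0 \<le> padic_residue (x :: 'p :: prime_card padic_int) n"
  by (metis CARD_prime_card_pos[where 'p = 'p] of_nat_0_less_iff padic_residue_mod_self
      pos_mod_sign zero_less_power)

lemma padic_residue_less:
  "padic_residue (x :: 'p :: prime_card padic_int) n < int CARD('p) ^ n"
  by (metis CARD_prime_card_pos[where 'p = 'p] of_nat_0_less_iff padic_residue_mod_self
      pos_mod_bound zero_less_power)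

lemma mod_power_Suc_mod: "(a :: int) mod q ^ Suc n mod q ^ n = a mod q ^ n"
  by (simp add: mod_mod_cancel)

instantiation padic_int :: (prime_card) comm_ring_1
begin

lift_definition zero_padic_int :: "'a padic_int" is "\<lambda>_. 0" by simp

lift_definition one_padic_int :: "'a padic_int" is "\<lambda>n. 1 mod int CARD('a) ^ n"
  by (metis mod_power_Suc_mod)

lift_definition plus_padic_int :: "'a padic_int \<Rightarrow> 'a padic_int \<Rightarrow> 'a padic_int"
  is "\<lambda>x y n. (x n + y n) mod int CARD('a) ^ n"
  by (metis mod_power_Suc_mod mod_add_eq)

lift_definition uminus_padic_int :: "'a padic_int \<Rightarrow> 'a padic_int"
  is "\<lambda>x n. (- x n) mod int CARD('a) ^ n"
  by (metis mod_power_Suc_mod mod_minus_eq)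

lift_definition minus_padic_int :: "'a padic_int \<Rightarrow> 'a padic_int \<Rightarrow> 'a padic_int"
  is "\<lambda>x y n. (x n - y n) mod int CARD('a) ^ n"
  by (metis mod_power_Suc_mod mod_diff_eq)

lift_definition times_padic_int :: "'a padic_int \<Rightarrow> 'a padic_int \<Rightarrow> 'a padic_int"
  is "\<lambda>x y n. (x n * y n) mod int CARD('a) ^ n"
  by (metis mod_power_Suc_mod mod_mult_eq)

instance
proof
  fix a b c :: "'a padic_int"
  note S = zero_padic_int.rep_eq one_padic_int.rep_eq plus_padic_int.rep_eq
    uminus_padic_int.rep_eq minus_padic_int.rep_eq times_padic_int.rep_eq
  show "a * b * c = a * (b * c)"
    by (rule padic_int_eqI) (simp add: S mod_simps algebra_simps)
  show "a * b = b * a"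
    by (rule padic_int_eqI) (simp add: S algebra_simps)
  show "1 * a = a"
    by (rule padic_int_eqI) (simp add: S mod_simps padic_residue_mod_self)
  show "a + b + c = a + (b + c)"
    by (rule padic_int_eqI) (simp add: S mod_simps algebra_simps)
  show "a + b = b + a"
    by (rule padic_int_eqI) (simp add: S algebra_simps)
  show "0 + a = a"
    by (rule padic_int_eqI) (simp add: S padic_residue_mod_self)
  show "- a + a = 0"
    by (rule padic_int_eqI) (simp add: S mod_simps)
  show "a - b = a + - b"
    by (rule padic_int_eqI) (simp add: S mod_simps)
  show "(a + b) * c = a * c + b * c"
    by (rule padic_int_eqI) (simp add: S mod_simps algebra_simps)
  have "padic_residue (0 :: 'a padic_int) 1 \<noteq> padic_residue 1 1"
    using CARD_prime_card_gt_1[where 'p = 'a] by (simp add: S)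
  then show "(0 :: 'a padic_int) \<noteq> 1" by auto
qed

end

lemmas padic_residue_simps = zero_padic_int.rep_eq one_padic_int.rep_eq plus_padic_int.rep_eq
  uminus_padic_int.rep_eq minus_padic_int.rep_eq times_padic_int.rep_eq

lemma padic_residue_of_nat:
  "padic_residue (of_nat k :: 'p :: prime_card padic_int) n = int k mod int CARD('p) ^ n"
  by (induction k) (simp_all add: padic_residue_simps mod_simps)

lemma padic_residue_of_int:
  "padic_residue (of_int k :: 'p :: prime_card padic_int) n = k mod int CARD('p) ^ n"
proof (cases k)
  case (nonneg m)
  then show ?thesis by (simp add: padic_residue_of_nat)
next
  case (neg m)
  have "(of_int k :: 'p padic_int) = - of_nat (Suc m)"
    unfolding neg by simp
  then show ?thesis
    by (simp only: padic_residue_of_nat padic_residue_simps neg mod_minus_eq)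
qed

text \<open>The residue modulo \<open>p ^ n\<close> vanishes exactly on the ideal generated by \<open>p ^ n\<close>.\<close>

lemma padic_power_dvd_iff:
  fixes x :: "'p :: prime_card padic_int"
  shows "of_nat CARD('p) ^ n dvd x \<longleftrightarrow> padic_residue x n = 0"
proof
  assume "of_nat CARD('p) ^ n dvd x"
  then obtain y where "x = of_nat (CARD('p) ^ n) * y" by (auto simp: dvd_def)
  then show "padic_residue x n = 0"
    by (simp only: times_padic_int.rep_eq padic_residue_of_nat) simp
next
  assume x: "padic_residue x n = 0"
  let ?q = "int CARD('p)"
  define y where "y = (\<lambda>k. padic_residue x (n + k) div ?q ^ n)"
  have q: "?q > 0" using CARD_prime_card_pos[where 'p = 'p] by simp
  have xy: "padic_residue x (n + k) = ?q ^ n * y k" for k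
  proof -
    have "padic_residue x (n + k) mod ?q ^ n = 0" using x by (simp add: padic_residue_mod)
    then show ?thesis unfolding y_def by (metis mult_div_mod_eq add.right_neutral)
  qed
  have "y k = y (Suc k) mod ?q ^ k" for k
  proof -
    have "padic_residue x (n + Suc k) mod ?q ^ (n + k) = padic_residue x (n + k)"
      by (rule padic_residue_mod) simp
    then have "?q ^ n * (y (Suc k) mod ?q ^ k) = ?q ^ n * y k"
      by (simp only: xy power_add mult_mod_right)
    then show ?thesis using q by simp
  qed
  then have res: "padic_residue (Abs_padic_int y :: 'p padic_int) k = y k" for k
    by (subst Abs_padic_int_inverse) (blast intro: refl)+
  have "x = of_nat (CARD('p) ^ n) * Abs_padic_int y"
  proof (rule padic_int_eqI)
    fix k
    have "padic_residue x k = padic_residue x (n + k) mod ?q ^ k"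
      by (simp add: padic_residue_mod)
    also have "\<dots> = padic_residue (of_nat (CARD('p) ^ n) * Abs_padic_int y :: 'p padic_int) k"
      by (simp only: times_padic_int.rep_eq padic_residue_of_nat res xy) (simp add: mod_simps)
    finally show "padic_residue x k
        = padic_residue (of_nat (CARD('p) ^ n) * Abs_padic_int y :: 'p padic_int) k" .
  qed
  then show "of_nat CARD('p) ^ n dvd x" by simp
qed

lemma padic_residue_zero_antimono:
  "padic_residue (x :: 'p :: prime_card padic_int) n = 0 \<Longrightarrow> m \<le> n \<Longrightarrow> padic_residue x m = 0"
  by (metis mod_0 padic_residue_mod)

section \<open>Absolute value and metric\<close>

text \<open>The \<open>p\<close>-adic order; only meaningful for \<open>x \<noteq> 0\<close>.\<close>

definition padic_ord :: "'p :: prime_card padic_int \<Rightarrow> nat" where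
  "padic_ord x = (GREATEST n. of_nat CARD('p) ^ n dvd x)"

definition padic_abs :: "'p :: prime_card padic_int \<Rightarrow> real" where
  "padic_abs x = (if x = 0 then 0 else real CARD('p) powi (- int (padic_ord x)))"

lemma padic_ord_iff:
  fixes x :: "'p :: prime_card padic_int"
  assumes "x \<noteq> 0"
  shows "n \<le> padic_ord x \<longleftrightarrow> padic_residue x n = 0"
proof -
  obtain k where k: "padic_residue x k \<noteq> 0"
    using assms padic_int_eqI[of x 0] by (auto simp: padic_residue_simps)
  have b: "n \<le> k" if "padic_residue x n = 0" for n
    using k padic_residue_zero_antimono[OF that] by (meson nat_le_linear)
  have 0: "padic_residue x 0 = 0" using padic_residue_mod_self[of x 0] by simp
  have ord: "padic_ord x = (GREATEST n. padic_residue x n = 0)"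
    unfolding padic_ord_def padic_power_dvd_iff ..
  have "padic_residue x (padic_ord x) = 0"
    unfolding ord by (rule GreatestI_nat[where P = "\<lambda>n. padic_residue x n = 0", OF 0]) (use b in auto)
  moreover have "n \<le> padic_ord x" if "padic_residue x n = 0"
    unfolding ord by (rule Greatest_le_nat[where P = "\<lambda>n. padic_residue x n = 0", OF that]) (use b in auto)
  ultimately show ?thesis using padic_residue_zero_antimono by blast
qed

lemma padic_abs_le_iff:
  fixes x :: "'p :: prime_card padic_int"
  shows "padic_abs x \<le> real CARD('p) powi (- int n) \<longleftrightarrow> padic_residue x n = 0"
proof (cases "x = 0")
  case True
  then show ?thesis by (simp add: padic_abs_def padic_residue_simps)
next
  case False
  have "real CARD('p) powi (- int (padic_ord x)) \<le> real CARD('p) powi (- int n)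
      \<longleftrightarrow> n \<le> padic_ord x"
    using CARD_prime_card_gt_1[where 'p = 'p] by (simp add: power_int_minus power_increasing_iff)
  then show ?thesis using False by (simp add: padic_abs_def padic_ord_iff)
qed

lemma padic_abs_nonneg [simp]: "0 \<le> padic_abs x"
  by (simp add: padic_abs_def)

lemma padic_abs_0_iff [simp]: "padic_abs (x :: 'p :: prime_card padic_int) = 0 \<longleftrightarrow> x = 0"
  using CARD_prime_card_gt_1[where 'p = 'p] by (simp add: padic_abs_def)

lemma padic_abs_uminus [simp]: "padic_abs (- x) = padic_abs (x :: 'p :: prime_card padic_int)"
  by (simp add: padic_abs_def padic_ord_def)

lemma padic_abs_minus_commute: "padic_abs (x - y) = padic_abs (y - x)"
  using padic_abs_uminus[of "x - y"] by simp

lemma padic_abs_add_le: "padic_abs (x + y) \<le> max (padic_abs x) (padic_abs y)"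
proof -
  have *: "padic_abs (x + y) \<le> padic_abs x" if le: "padic_abs y \<le> padic_abs x" for x y :: "'a padic_int"
  proof (cases "x = 0")
    case True
    then have "padic_abs y \<le> 0" using le by (simp add: padic_abs_def)
    then have "y = 0" using padic_abs_0_iff[of y] padic_abs_nonneg[of y] by linarith
    with True show ?thesis by simp
  next
    case False
    let ?n = "padic_ord x"
    have x: "padic_abs x = real CARD('a) powi (- int ?n)" using False by (simp add: padic_abs_def)
    have "padic_residue x ?n = 0" "padic_residue y ?n = 0"
      using le padic_abs_le_iff[of x ?n] padic_abs_le_iff[of y ?n] x by auto
    then have "padic_residue (x + y) ?n = 0" by (simp add: padic_residue_simps)
    then show ?thesis unfolding x padic_abs_le_iff .
  qed
  show ?thesis
    using *[of x y] *[of y x] by (auto simp: add.commute max_def)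
qed

instantiation padic_int :: (prime_card) metric_space
begin

definition dist_padic_int :: "'a padic_int \<Rightarrow> 'a padic_int \<Rightarrow> real" where
  "dist_padic_int x y = padic_abs (x - y)"

definition uniformity_padic_int :: "('a padic_int \<times> 'a padic_int) filter" where
  "uniformity_padic_int = (INF e\<in>{0 <..}. principal {(x, y). dist x y < e})"

definition open_padic_int :: "'a padic_int set \<Rightarrow> bool" where
  "open_padic_int U = (\<forall>x\<in>U. eventually (\<lambda>(x', y). x' = x \<longrightarrow> y \<in> U) uniformity)"

instance
proof
  fix x y z :: "'a padic_int"
  show "dist x y = 0 \<longleftrightarrow> x = y" by (simp add: dist_padic_int_def)
  have "padic_abs (x - y) \<le> max (padic_abs (x - z)) (padic_abs (z - y))"
    using padic_abs_add_le[of "x - z" "z - y"] by simp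
  also have "\<dots> \<le> padic_abs (x - z) + padic_abs (y - z)"
    using padic_abs_nonneg[of "x - z"] padic_abs_nonneg[of "y - z"]
    by (simp add: padic_abs_minus_commute[of z y])
  finally show "dist x y \<le> dist x z + dist y z" by (simp add: dist_padic_int_def)
qed (simp_all add: uniformity_padic_int_def open_padic_int_def)

end

lemma padic_dist_le_iff:
  fixes x y :: "'p :: prime_card padic_int"
  shows "dist x y \<le> real CARD('p) powi (- int n) \<longleftrightarrow> padic_residue x n = padic_residue y n"
proof -
  have "padic_residue (x - y) n = 0 \<longleftrightarrow> padic_residue x n = padic_residue y n"
    by (metis diff_self minus_padic_int.rep_eq mod_0 mod_eq_dvd_iff dvd_eq_mod_eq_0
        padic_residue_mod_self)
  then show ?thesis by (simp add: dist_padic_int_def padic_abs_le_iff)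
qed

section \<open>Digits\<close>

text \<open>
  \<open>padic_digit x i\<close> is the coefficient of \<open>p ^ i\<close> in the canonical expansion of \<open>x\<close>; see
  \<open>padic_digit_less\<close>, \<open>padic_digit_sums\<close> and \<open>padic_digit_unique\<close> below.
\<close>

definition padic_digit :: "'p :: prime_card padic_int \<Rightarrow> nat \<Rightarrow> nat" where
  "padic_digit x i = nat (padic_residue x (Suc i) div int CARD('p) ^ i)"

lemma padic_residue_Suc:
  fixes x :: "'p :: prime_card padic_int"
  shows "padic_residue x (Suc n)
       = padic_residue x n + int (padic_digit x n) * int CARD('p) ^ n"
proof -
  have "0 \<le> padic_residue x (Suc n) div int CARD('p) ^ n"
    using padic_residue_nonneg[of x "Suc n"] by (simp add: pos_imp_zdiv_nonneg_iff CARD_prime_card_pos)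
  then have "int (padic_digit x n) = padic_residue x (Suc n) div int CARD('p) ^ n"
    by (simp add: padic_digit_def)
  then show ?thesis
    using div_mult_mod_eq[of "padic_residue x (Suc n)" "int CARD('p) ^ n"]
    by (simp add: padic_residue_Suc_mod)
qed

lemma padic_digit_less: "padic_digit (x :: 'p :: prime_card padic_int) i < CARD('p)"
proof -
  have "int (padic_digit x i) * int CARD('p) ^ i < int CARD('p) * int CARD('p) ^ i"
    using padic_residue_Suc[of x i] padic_residue_less[of x "Suc i"] padic_residue_nonneg[of x i]
    unfolding power_Suc by linarith
  then show ?thesis using CARD_prime_card_pos[where 'p = 'p] by (simp add: mult_less_cancel_right)
qed

lemma padic_residue_eq_sum:
  fixes x :: "'p :: prime_card padic_int"
  shows "padic_residue x n = int (\<Sum>i<n. padic_digit x i * CARD('p) ^ i)"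
proof (induction n)
  case 0
  show ?case using padic_residue_mod_self[of x 0] by simp
next
  case (Suc n)
  then show ?case by (simp add: padic_residue_Suc)
qed

lemma padic_tendsto_iff:
  fixes x :: "'p :: prime_card padic_int"
  shows "(X \<longlonglongrightarrow> x) \<longleftrightarrow> (\<forall>n. \<forall>\<^sub>F k in sequentially. padic_residue (X k) n = padic_residue x n)"
proof
  assume X: "X \<longlonglongrightarrow> x"
  show "\<forall>n. \<forall>\<^sub>F k in sequentially. padic_residue (X k) n = padic_residue x n"
  proof
    fix n
    have "0 < real CARD('p) powi (- int n)"
      using CARD_prime_card_pos[where 'p = 'p] by (simp add: zero_less_power_int)
    then have "\<forall>\<^sub>F k in sequentially. dist (X k) x < real CARD('p) powi (- int n)"
      using X tendstoD by blast
    then show "\<forall>\<^sub>F k in sequentially. padic_residue (X k) n = padic_residue x n"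
      by eventually_elim (metis less_imp_le padic_dist_le_iff)
  qed
next
  assume *: "\<forall>n. \<forall>\<^sub>F k in sequentially. padic_residue (X k) n = padic_residue x n"
  show "X \<longlonglongrightarrow> x"
  proof (rule tendstoI)
    fix e :: real assume "0 < e"
    moreover have "inverse (real CARD('p)) < 1"
      using CARD_prime_card_gt_1[where 'p = 'p] by (simp add: field_simps)
    ultimately obtain n where n: "inverse (real CARD('p)) ^ n < e"
      using real_arch_pow_inv by blast
    have "\<forall>\<^sub>F k in sequentially. padic_residue (X k) n = padic_residue x n" using * by blast
    then show "\<forall>\<^sub>F k in sequentially. dist (X k) x < e"
    proof eventually_elim
      case (elim k)
      then have "dist (X k) x \<le> real CARD('p) powi (- int n)" by (simp add: padic_dist_le_iff)
      also have "\<dots> = inverse (real CARD('p)) ^ n" by (simp add: power_int_minus power_inverse)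
      finally show ?case using n by simp
    qed
  qed
qed

lemma sum_digits_less:
  fixes d :: "nat \<Rightarrow> nat"
  assumes "\<And>i. d i < q"
  shows "(\<Sum>i<n. d i * q ^ i) < q ^ n"
proof (induction n)
  case (Suc n)
  have "(\<Sum>i<Suc n. d i * q ^ i) < q ^ n + d n * q ^ n" using Suc by simp
  also have "\<dots> = Suc (d n) * q ^ n" by simp
  also have "\<dots> \<le> q * q ^ n" using assms[of n] by (intro mult_right_mono) auto
  finally show ?case by simp
qed simp

lemma sum_digits_mod:
  fixes d :: "nat \<Rightarrow> nat"
  assumes "\<And>i. d i < q" and "n \<le> N"
  shows "(\<Sum>i<N. d i * q ^ i) mod q ^ n = (\<Sum>i<n. d i * q ^ i)"
  using assms(2)
proof (induction N rule: dec_induct)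
  case base
  show ?case using sum_digits_less[OF assms(1)] by simp
next
  case (step N)
  have "q ^ n dvd d N * q ^ N" using step by (simp add: le_imp_power_dvd)
  then have "(\<Sum>i<Suc N. d i * q ^ i) mod q ^ n = (\<Sum>i<N. d i * q ^ i) mod q ^ n"
    by (simp add: mod_add_right_eq[symmetric] del: mod_add_right_eq)
  then show ?case using step.IH by simp
qed

theorem padic_digit_sums:
  fixes x :: "'p :: prime_card padic_int"
  shows "(\<lambda>i. of_nat (padic_digit x i) * of_nat CARD('p) ^ i) sums x"
  unfolding sums_def padic_tendsto_iff
proof
  fix n
  show "\<forall>\<^sub>F k in sequentially. padic_residue
      (\<Sum>i<k. of_nat (padic_digit x i) * of_nat CARD('p) ^ i :: 'p padic_int) n = padic_residue x n"
    using eventually_ge_at_top[of n]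
  proof eventually_elim
    case (elim k)
    have "(\<Sum>i<k. of_nat (padic_digit x i) * of_nat CARD('p) ^ i :: 'p padic_int)
        = of_nat (\<Sum>i<k. padic_digit x i * CARD('p) ^ i)" by simp
    then show ?case
      using padic_residue_mod[OF elim, of x]
      by (simp only: padic_residue_of_nat padic_residue_eq_sum[of x k])
  qed
qed

theorem padic_digit_unique:
  fixes x :: "'p :: prime_card padic_int"
  assumes d: "\<And>i. d i < CARD('p)"
    and sums: "(\<lambda>i. of_nat (d i) * of_nat CARD('p) ^ i) sums x"
  shows "d = padic_digit x"
proof
  have res: "padic_residue x n = int (\<Sum>i<n. d i * CARD('p) ^ i)" for n
  proof -
    have "\<forall>\<^sub>F k in sequentially. padic_residue
        (\<Sum>i<k. of_nat (d i) * of_nat CARD('p) ^ i :: 'p padic_int) n = padic_residue x n"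
      using sums unfolding sums_def padic_tendsto_iff by blast
    then have "\<forall>\<^sub>F k in sequentially. k \<ge> n \<and> padic_residue
        (\<Sum>i<k. of_nat (d i) * of_nat CARD('p) ^ i :: 'p padic_int) n = padic_residue x n"
      using eventually_ge_at_top[of n] by eventually_elim simp
    then obtain k where k: "n \<le> k" "padic_residue
        (\<Sum>i<k. of_nat (d i) * of_nat CARD('p) ^ i :: 'p padic_int) n = padic_residue x n"
      by (metis (mono_tags, lifting) eventually_happens' sequentially_bot)
    have "(\<Sum>i<k. of_nat (d i) * of_nat CARD('p) ^ i :: 'p padic_int)
        = of_nat (\<Sum>i<k. d i * CARD('p) ^ i)" by simp
    then have "padic_residue x n = int (\<Sum>i<k. d i * CARD('p) ^ i) mod int CARD('p) ^ n"
      using k(2) by (simp only: padic_residue_of_nat)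
    also have "\<dots> = int ((\<Sum>i<k. d i * CARD('p) ^ i) mod CARD('p) ^ n)"
      by (simp only: zmod_int of_nat_power)
    finally show ?thesis by (simp only: sum_digits_mod[OF d k(1)])
  qed
  fix i
  have "int (d i) * int CARD('p) ^ i = int (padic_digit x i) * int CARD('p) ^ i"
    using padic_residue_Suc[of x i] unfolding res by simp
  then show "d i = padic_digit x i" using CARD_prime_card_pos[where 'p = 'p] by simp
qed

section \<open>Van der Put basis\<close>

definition van_der_put :: "nat \<Rightarrow> 'p :: prime_card padic_int \<Rightarrow> 'p padic_int" where
  "van_der_put m x =
    (if m = 0 then (if padic_abs x \<le> real CARD('p) powi (- 1) then 1 else 0)
     else (if padic_abs (x - of_nat m)
               \<le> real CARD('p) powi (- \<lfloor>log (real CARD('p)) (real m)\<rfloor> - 1) then 1 else 0))"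

section \<open>Haar measure\<close>

text \<open>
  Regularity is automatic for a finite Borel measure on a compact metric space, so it is not
  required. Such a measure exists by \<open>ex_normalized_haar_measure\<close> below.
\<close>

definition normalized_haar_measure :: "'p :: prime_card padic_int measure \<Rightarrow> bool" where
  "normalized_haar_measure \<mu> \<longleftrightarrow> sets \<mu> = sets borel \<and> emeasure \<mu> UNIV = 1 \<and>
     (\<forall>a. \<forall>A\<in>sets \<mu>. emeasure \<mu> ((+) a ` A) = emeasure \<mu> A)"

lemma open_padic_cylinder: "open {x :: 'p :: prime_card padic_int. padic_residue x n = a}"
proof (subst open_dist, safe)
  fix x :: "'p padic_int"
  let ?e = "real CARD('p) powi (- int n)"
  have "0 < ?e" using CARD_prime_card_pos[where 'p = 'p] by (simp add: zero_less_power_int)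
  then show "\<exists>e>0. \<forall>y. dist y x < e \<longrightarrow> y \<in> {y. padic_residue y n = padic_residue x n}"
    by (intro exI[of _ ?e]) (auto simp: padic_dist_le_iff[symmetric])
qed

lemma borel_padic_int:
  "(borel :: 'p :: prime_card padic_int measure)
   = sigma UNIV (range (\<lambda>(n, a). {x. padic_residue x n = a}))"
proof (rule borel_eq_countable_basis)
  show "topological_basis (range (\<lambda>(n, a). {x :: 'p padic_int. padic_residue x n = a}))"
  proof (rule topological_basisI)
    fix U and x :: "'p padic_int"
    assume "open U" "x \<in> U"
    then obtain e where e: "0 < e" "\<And>y. dist y x < e \<Longrightarrow> y \<in> U" unfolding open_dist by blast
    have "inverse (real CARD('p)) < 1"
      using CARD_prime_card_gt_1[where 'p = 'p] by (simp add: field_simps)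
    then obtain n where n: "inverse (real CARD('p)) ^ n < e"
      using real_arch_pow_inv e(1) by blast
    have "y \<in> U" if "padic_residue y n = padic_residue x n" for y
    proof (rule e(2))
      have "dist y x \<le> real CARD('p) powi (- int n)" using that by (simp add: padic_dist_le_iff)
      also have "\<dots> = inverse (real CARD('p)) ^ n" by (simp add: power_int_minus power_inverse)
      finally show "dist y x < e" using n by simp
    qed
    then show "\<exists>B'\<in>range (\<lambda>(n, a). {x :: 'p padic_int. padic_residue x n = a}). x \<in> B' \<and> B' \<subseteq> U"
      by (intro bexI[of _ "{y. padic_residue y n = padic_residue x n}"]) auto
  qed (auto simp: open_padic_cylinder)
qed simp

lemma padic_measure_eqI:
  fixes M N :: "'p :: prime_card padic_int measure"
  assumes "sets M = sets borel" "sets N = sets borel" "emeasure M UNIV \<noteq> \<infinity>"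
    and eq: "\<And>n a. emeasure M {x. padic_residue x n = a} = emeasure N {x. padic_residue x n = a}"
  shows "M = N"
proof -
  let ?E = "range (\<lambda>(n, a). {x :: 'p padic_int. padic_residue x n = a})"
  have res0: "padic_residue x 0 = 0" for x :: "'p padic_int"
    using padic_residue_mod_self[of x 0] by simp
  show ?thesis
  proof (rule measure_eqI_generator_eq[where E = ?E and \<Omega> = UNIV
        and A = "\<lambda>_. {x. padic_residue x 0 = 0}"])
    have *: "{x :: 'p padic_int. padic_residue x n = a} \<inter> {x. padic_residue x m = b} \<in> ?E"
      if "n \<le> m" for n m a b
    proof (cases "b mod int CARD('p) ^ n = a")
      case True
      then have "{x :: 'p padic_int. padic_residue x n = a} \<inter> {x. padic_residue x m = b}
          = {x. padic_residue x m = b}"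
        using padic_residue_mod[OF that, where 'p = 'p] by auto
      then show ?thesis by auto
    next
      case False
      then have "{x :: 'p padic_int. padic_residue x n = a} \<inter> {x. padic_residue x m = b}
          = {x. padic_residue x 0 = 1}"
        using padic_residue_mod[OF that, where 'p = 'p] by (auto simp: res0)
      then show ?thesis by auto
    qed
    show "Int_stable ?E"
    proof (rule Int_stableI)
      fix A B assume "A \<in> ?E" "B \<in> ?E"
      then obtain n a m b where AB: "A = {x. padic_residue x n = a}" "B = {x. padic_residue x m = b}"
        by auto
      show "A \<inter> B \<in> ?E"
      proof (cases "n \<le> m")
        case True
        then show ?thesis unfolding AB by (rule *)
      next
        case False
        then have "B \<inter> A \<in> ?E" unfolding AB by (intro *) simp
        then show ?thesis by (simp only: Int_commute)
      qed
    qed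
    show "emeasure M X = emeasure N X" if "X \<in> ?E" for X using that eq by auto
    show "sets M = sigma_sets UNIV ?E" "sets N = sigma_sets UNIV ?E"
      using assms(1,2) by (simp_all add: borel_padic_int)
    show "range (\<lambda>_. {x :: 'p padic_int. padic_residue x 0 = 0}) \<subseteq> ?E" by auto
  qed (use assms(3) in \<open>auto simp: res0\<close>)
qed

lemma ex_uniform_padic_measure:
  obtains M :: "'p :: prime_card padic_int measure"
  where "sets M = sets borel"
    and "\<And>n a. 0 \<le> a \<Longrightarrow> a < int CARD('p) ^ n \<Longrightarrow>
           emeasure M {x. padic_residue x n = a} = ennreal ((1 / real CARD('p)) ^ n)"
proof -
  let ?q = "CARD('p)"
  have q: "?q > 0" by (rule CARD_prime_card_pos)
  define U where "U = (\<lambda>_ :: nat. measure_pmf (pmf_of_set {..<?q}))"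
  interpret U: product_prob_space U UNIV
    unfolding U_def by unfold_locales
  define s where "s d n = (\<Sum>i<n. (d i mod ?q) * ?q ^ i)" for d :: "nat \<Rightarrow> nat" and n
  define g :: "(nat \<Rightarrow> nat) \<Rightarrow> 'p padic_int" where "g d = Abs_padic_int (\<lambda>n. int (s d n))" for d
  have g: "padic_residue (g d) n = int (s d n)" for d n
  proof -
    have "s d n = s d (Suc n) mod ?q ^ n" for n
      unfolding s_def using q by (intro sum_digits_mod[symmetric]) auto
    then have "int (s d n) = int (s d (Suc n)) mod int ?q ^ n" for n
      by (metis of_nat_power zmod_int)
    then show ?thesis unfolding g_def by (subst Abs_padic_int_inverse) (blast intro: refl)+
  qed
  have digit_g: "padic_digit (g d) i = d i mod ?q" for d i
  proof -
    have "int (padic_digit (g d) i) * int ?q ^ i = int (d i mod ?q) * int ?q ^ i"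
      using padic_residue_Suc[of "g d" i] unfolding g s_def by simp
    then show ?thesis using q by simp
  qed
  have s_eq: "s d n = s d' n \<longleftrightarrow> (\<forall>i<n. d i mod ?q = d' i mod ?q)" for d d' n
  proof
    assume eq: "s d n = s d' n"
    show "\<forall>i<n. d i mod ?q = d' i mod ?q"
    proof safe
      fix i assume i: "i < n"
      have "padic_residue (g d) (Suc i) = padic_residue (g d') (Suc i)"
        using eq i padic_residue_mod[of "Suc i" n "g d"] padic_residue_mod[of "Suc i" n "g d'"]
        by (simp add: g)
      then have "padic_digit (g d) i = padic_digit (g d') i" by (simp add: padic_digit_def)
      then show "d i mod ?q = d' i mod ?q" by (simp add: digit_g)
    qed
  qed (simp add: s_def)
  have pre: "g -` {x. padic_residue x n = a}
      = prod_emb UNIV U {..<n} (\<Pi>\<^sub>E i\<in>{..<n}. {k. k mod ?q = padic_digit (of_int a :: 'p padic_int) i})"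
    if "0 \<le> a" "a < int ?q ^ n" for n a
  proof -
    let ?c = "padic_digit (of_int a :: 'p padic_int)"
    have "int (s ?c n) = a"
      using padic_residue_eq_sum[of "of_int a :: 'p padic_int" n] that
      by (simp add: s_def padic_residue_of_int padic_digit_less del: of_nat_sum)
    then have "padic_residue (g d) n = a \<longleftrightarrow> (\<forall>i<n. d i mod ?q = ?c i)" for d
      using s_eq[of d n ?c] by (simp add: g padic_digit_less) (metis of_nat_eq_iff)
    then show ?thesis
      by (auto simp: prod_emb_def U_def space_PiM PiE_iff)
  qed
  have meas: "g \<in> measurable (PiM UNIV U) borel"
    unfolding borel_padic_int
  proof (rule measurable_sigma_sets)
    show "sets (sigma UNIV (range (\<lambda>(n, a). {x :: 'p padic_int. padic_residue x n = a})))
        = sigma_sets UNIV (range (\<lambda>(n, a). {x :: 'p padic_int. padic_residue x n = a}))" by simp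
    fix A assume "A \<in> range (\<lambda>(n, a). {x :: 'p padic_int. padic_residue x n = a})"
    then obtain n a where A: "A = {x. padic_residue x n = a}" by auto
    show "g -` A \<inter> space (PiM UNIV U) \<in> sets (PiM UNIV U)"
    proof (cases "0 \<le> a \<and> a < int ?q ^ n")
      case True
      then show ?thesis unfolding A by (subst pre) (auto simp: U_def intro!: sets_PiM_I sets.Int)
    next
      case False
      then have "A = {}" using padic_residue_nonneg padic_residue_less unfolding A by blast
      then show ?thesis by simp
    qed
  qed auto
  have coord: "emeasure (U i) {k. k mod ?q = c} = ennreal (1 / real ?q)" if "c < ?q" for i c
  proof -
    have "{..<?q} \<inter> {k. k mod ?q = c} = {c}" using that by auto
    then show ?thesis using q
      by (simp add: U_def emeasure_pmf_of_set lessThan_empty_iff divide_ennreal[symmetric] ennreal_of_nat_eq_real_of_nat)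
  qed
  show ?thesis
  proof (rule that[of "distr (PiM UNIV U) borel g"])
    fix n a assume a: "0 \<le> a" "a < int ?q ^ n"
    have "{x :: 'p padic_int. padic_residue x n = a} \<in> sets borel"
      using open_padic_cylinder by (rule borel_open)
    then have "emeasure (distr (PiM UNIV U) borel g) {x. padic_residue x n = a}
        = emeasure (PiM UNIV U) (g -` {x. padic_residue x n = a} \<inter> space (PiM UNIV U))"
      by (rule emeasure_distr[OF meas])
    also have "space (PiM UNIV U) = UNIV" by (simp add: U_def space_PiM)
    also have "emeasure (PiM UNIV U) (g -` {x. padic_residue x n = a} \<inter> UNIV)
        = (\<Prod>i<n. emeasure (U i) {k. k mod ?q = padic_digit (of_int a :: 'p padic_int) i})"
      unfolding Int_UNIV_right pre[OF a] by (rule U.emeasure_PiM_emb) (auto simp: U_def)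
    also have "\<dots> = ennreal ((1 / real ?q) ^ n)"
      by (simp add: coord padic_digit_less ennreal_power)
    finally show "emeasure (distr (PiM UNIV U) borel g) {x. padic_residue x n = a}
        = ennreal ((1 / real ?q) ^ n)" .
  qed simp
qed

theorem ex_normalized_haar_measure:
  "\<exists>\<mu> :: 'p :: prime_card padic_int measure. normalized_haar_measure \<mu>"
proof -
  let ?q = "int CARD('p)"
  obtain M :: "'p padic_int measure" where M: "sets M = sets borel"
    and cyl: "\<And>n a. 0 \<le> a \<Longrightarrow> a < ?q ^ n \<Longrightarrow>
           emeasure M {x. padic_residue x n = a} = ennreal ((1 / real CARD('p)) ^ n)"
    using ex_uniform_padic_measure by blast
  have q: "?q ^ n > 0" for n using CARD_prime_card_pos[where 'p = 'p] by simp
  have "padic_residue x 0 = 0" for x :: "'p padic_int"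
    using padic_residue_mod_self[of x 0] by simp
  then have total: "emeasure M UNIV = 1" using cyl[of 0 0] by simp
  have "emeasure M ((+) a ` A) = emeasure M A" if A: "A \<in> sets M" for a A
  proof -
    have "continuous_on UNIV (\<lambda>x. x - a)"
      unfolding continuous_on_iff by (auto simp: dist_padic_int_def)
    then have mb: "(\<lambda>x. x - a) \<in> borel_measurable borel" by (rule borel_measurable_continuous_onI)
    have ms: "(\<lambda>x. x - a) \<in> measurable M borel"
      using mb measurable_cong_sets[OF M refl] by blast
    have sp: "space M = UNIV" using sets_eq_imp_space_eq[OF M] by simp
    have "distr M borel (\<lambda>x. x - a) = M"
    proof (rule padic_measure_eqI)
      show "emeasure (distr M borel (\<lambda>x. x - a)) UNIV \<noteq> \<infinity>"
        using total by (simp add: emeasure_distr[OF ms] sp)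
      fix n b
      let ?c = "(b + padic_residue a n) mod ?q ^ n"
      have "emeasure (distr M borel (\<lambda>x. x - a)) {x. padic_residue x n = b}
          = emeasure M {x. padic_residue (x - a) n = b}"
        using emeasure_distr[OF ms, of "{x. padic_residue x n = b}"] borel_open[OF open_padic_cylinder[of n b]]
        by (simp add: sp vimage_def)
      also have "\<dots> = emeasure M {x. padic_residue x n = b}"
      proof (cases "0 \<le> b \<and> b < ?q ^ n")
        case True
        have "padic_residue (x - a) n = b \<longleftrightarrow> padic_residue x n = ?c" for x
        proof
          assume "padic_residue (x - a) n = b"
          then have "?c = (padic_residue x n - padic_residue a n + padic_residue a n) mod ?q ^ n"
            unfolding minus_padic_int.rep_eq by (metis mod_add_left_eq)
          then show "padic_residue x n = ?c" by (simp add: padic_residue_mod_self)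
        next
          assume "padic_residue x n = ?c"
          then have "padic_residue (x - a) n = b mod ?q ^ n"
            by (simp add: minus_padic_int.rep_eq mod_simps)
          then show "padic_residue (x - a) n = b" using True by simp
        qed
        then have "emeasure M {x. padic_residue (x - a) n = b} = emeasure M {x. padic_residue x n = ?c}"
          by simp
        also have "\<dots> = emeasure M {x. padic_residue x n = b}"
          using True q[of n] by (simp add: cyl)
        finally show ?thesis .
      next
        case False
        then have "{x :: 'p padic_int. padic_residue (x - a) n = b} = {}"
          "{x :: 'p padic_int. padic_residue x n = b} = {}"
          using padic_residue_nonneg padic_residue_less by blast+
        then show ?thesis by simp
      qed
      finally show "emeasure (distr M borel (\<lambda>x. x - a)) {x. padic_residue x n = b}
          = emeasure M {x. padic_residue x n = b}" .
    qed (simp_all add: M)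
    moreover have "(+) a ` A = (\<lambda>x. x - a) -` A" by (force simp: image_iff)
    ultimately show ?thesis
      using emeasure_distr[OF ms, of A] A M sp by simp
  qed
  then have "normalized_haar_measure M"
    unfolding normalized_haar_measure_def using M total by simp
  then show ?thesis ..
qed

definition measure_preserving_map :: "'a measure \<Rightarrow> ('a \<Rightarrow> 'a) \<Rightarrow> bool" where
  "measure_preserving_map \<mu> f \<longleftrightarrow> f \<in> measurable \<mu> \<mu> \<and>
     (\<forall>A\<in>sets \<mu>. emeasure \<mu> (f -` A \<inter> space \<mu>) = emeasure \<mu> A)"

end

theory Submission
  imports Defs
begin

text \<open>
  Since \<open>B m = f m - f (m mod p ^ (n - 1))\<close>, the coefficients with \<open>p ^ (n - 1) \<le> m < p ^ n\<close> add up
  to \<open>F n - p * F (n - 1)\<close>, where \<open>F n\<close> is the sum of \<open>f m\<close> over \<open>m < p ^ n\<close>. A measure-preserving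
  1-Lipschitz \<open>f\<close> permutes the residues modulo \<open>p ^ n\<close>, so \<open>F n\<close> is
  \<open>p ^ n * (p ^ n - 1) / 2 + p ^ n * S n\<close> modulo \<open>p ^ (n + 1)\<close>. With \<open>e = p ^ (n - 1) * (p - 1) / 2\<close> this
  gives \<open>p ^ n * (S n - S (n - 1) + e)\<close> for the sum of the \<open>B m\<close> modulo \<open>p ^ (n + 1)\<close>. In each class
  modulo \<open>p ^ (n - 1)\<close> the leading digits of the \<open>b m\<close> run through \<open>1, \<dots>, p - 1\<close>, which gives
  \<open>p * (T n + e)\<close> for the sum of the \<open>b m\<close> modulo \<open>p ^ 2\<close>. The correction \<open>e\<close> vanishes modulo \<open>p\<close>
  unless \<open>p = n = 2\<close>, where \<open>e = 1\<close>.
\<close>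

section \<open>Residues and divisibility by powers of p\<close>

lemma padic_residue_diff_eq_0_iff:
  fixes x y :: "'p :: prime_card padic_int"
  shows "padic_residue (x - y) n = 0 \<longleftrightarrow> padic_residue x n = padic_residue y n"
  by (metis padic_abs_le_iff padic_dist_le_iff dist_padic_int_def)

lemma padic_power_dvd_diff_iff:
  fixes x y :: "'p :: prime_card padic_int"
  shows "of_nat CARD('p) ^ n dvd x - y \<longleftrightarrow> padic_residue x n = padic_residue y n"
  by (simp only: padic_power_dvd_iff padic_residue_diff_eq_0_iff)

lemma padic_power_dvd_diff_residue:
  fixes x :: "'p :: prime_card padic_int"
  shows "of_nat CARD('p) ^ n dvd x - of_int (padic_residue x n)"
  by (simp only: padic_power_dvd_diff_iff padic_residue_of_int padic_residue_mod_self)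

lemma padic_power_dvd_of_int_iff:
  "(of_nat CARD('p) ^ n :: 'p :: prime_card padic_int) dvd of_int z \<longleftrightarrow> int CARD('p) ^ n dvd z"
  by (simp add: padic_power_dvd_iff padic_residue_of_int dvd_eq_mod_eq_0)

text \<open>Cancellation takes place on residues: the residue of \<open>p ^ j * x\<close> modulo
  \<open>p ^ (j + k)\<close> is \<open>p ^ j\<close> times that of \<open>x\<close> modulo
  \<open>p ^ k\<close>. No appeal to the absence of zero divisors is made.\<close>

lemma padic_power_add_dvd_iff:
  fixes x :: "'p :: prime_card padic_int"
  shows "of_nat CARD('p) ^ (j + k) dvd of_nat CARD('p) ^ j * x \<longleftrightarrow> of_nat CARD('p) ^ k dvd x"
proof -
  let ?q = "int CARD('p)"
  have "padic_residue (of_nat (CARD('p) ^ j) * x) (j + k)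
      = (?q ^ j * padic_residue x (j + k)) mod ?q ^ (j + k)"
    unfolding times_padic_int.rep_eq padic_residue_of_nat by (simp add: mod_mult_left_eq)
  also have "\<dots> = ?q ^ j * padic_residue x k"
    using padic_residue_mod[of k "j + k" x] by (simp add: power_add mult_mod_right)
  finally show ?thesis
    using CARD_prime_card_pos[where 'p = 'p] by (simp add: padic_power_dvd_iff)
qed

text \<open>Transfers congruences to the integers: once a p-adic sum is known modulo
  \<open>p ^ n\<close> through an integer \<open>y\<close>, comparing it with any other integer is a
  question about \<open>y\<close> alone.\<close>

lemma padic_dvd_cong_of_int:
  fixes x :: "'p :: prime_card padic_int"
  assumes "of_nat CARD('p) ^ n dvd x - of_int y"
  shows "of_nat CARD('p) ^ n dvd x - of_int z \<longleftrightarrow> int CARD('p) ^ n dvd y - z"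
proof -
  have "x - of_int z = (x - of_int y) + of_int (y - z)" by simp
  then show ?thesis
    using assms padic_power_dvd_of_int_iff[of n "y - z", where 'p = 'p]
    by (metis dvd_add_right_iff)
qed

section \<open>Measure-preserving maps on residues\<close>

lemma normalized_haar_measure_cylinder_neq_0:
  fixes \<mu> :: "'p :: prime_card padic_int measure"
  assumes haar: "normalized_haar_measure \<mu>" and a: "0 \<le> a" "a < int CARD('p) ^ n"
  shows "emeasure \<mu> {x. padic_residue x n = a} \<noteq> 0"
proof
  assume zero: "emeasure \<mu> {x. padic_residue x n = a} = 0"
  have sets: "sets \<mu> = sets borel" and total: "emeasure \<mu> UNIV = 1"
    and trans: "\<And>c A. A \<in> sets \<mu> \<Longrightarrow> emeasure \<mu> ((+) c ` A) = emeasure \<mu> A"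
    using haar unfolding normalized_haar_measure_def by auto
  have cyl: "{x. padic_residue x n = c} \<in> sets \<mu>" for c
    using borel_open[OF open_padic_cylinder] sets by simp
  \<comment> \<open>All cylinders of level \<open>n\<close> are translates of the given one, hence
    null with it. Finitely many of them cover the space, against total mass 1.\<close>
  have null: "{x. padic_residue x n = c} \<in> null_sets \<mu>" if c: "0 \<le> c" "c < int CARD('p) ^ n" for c
  proof -
    have "(+) (of_int (c - a)) ` {x :: 'p padic_int. padic_residue x n = a}
        = {x. padic_residue x n = c}"
    proof (intro equalityI subsetI)
      fix x :: "'p padic_int"
      assume "x \<in> {x. padic_residue x n = c}"
      then have "x - of_int (c - a) \<in> {x. padic_residue x n = a}"
        using a by (simp add: padic_residue_simps padic_residue_of_int mod_simps)
      then show "x \<in> (+) (of_int (c - a)) ` {x. padic_residue x n = a}"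
        by (metis add_diff_cancel_left' diff_add_cancel add.commute imageI)
    next
      fix x :: "'p padic_int"
      assume "x \<in> (+) (of_int (c - a)) ` {x. padic_residue x n = a}"
      then show "x \<in> {x. padic_residue x n = c}"
        using c by (auto simp: padic_residue_simps padic_residue_of_int mod_simps)
    qed
    then show ?thesis
      using trans[OF cyl, of "of_int (c - a)" a] zero cyl by (metis null_setsI)
  qed
  have "(\<Union>c\<in>{0..<int CARD('p) ^ n}. {x :: 'p padic_int. padic_residue x n = c}) \<in> null_sets \<mu>"
    using null by (intro null_sets.finite_UN) auto
  also have "(\<Union>c\<in>{0..<int CARD('p) ^ n}. {x :: 'p padic_int. padic_residue x n = c}) = UNIV"
    using padic_residue_nonneg padic_residue_less by auto
  finally show False using total by auto
qed

lemma lipschitz_padic_residue_cong: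
  fixes f :: "'p :: prime_card padic_int \<Rightarrow> 'p padic_int"
  assumes "1-lipschitz_on UNIV f" and "padic_residue x n = padic_residue y n"
  shows "padic_residue (f x) n = padic_residue (f y) n"
proof -
  have "dist (f x) (f y) \<le> dist x y" using lipschitz_onD[OF assms(1), of x y] by simp
  then show ?thesis using assms(2) padic_dist_le_iff[of x y n] padic_dist_le_iff[of "f x" "f y" n]
    by linarith
qed

text \<open>The preimage of a cylinder has the nonzero measure of the cylinder, so it contains some
  \<open>x\<close>. By the Lipschitz condition \<open>x\<close> may be replaced by its least residue
  \<open>k\<close>, which gives surjectivity; equal cardinalities then give injectivity.\<close>

lemma measure_preserving_bij_betw_residues:
  fixes f :: "'p :: prime_card padic_int \<Rightarrow> 'p padic_int"
  assumes haar: "normalized_haar_measure \<mu>" and mp: "measure_preserving_map \<mu> f"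
    and lip: "1-lipschitz_on UNIV f"
  shows "bij_betw (\<lambda>k. padic_residue (f (of_nat k)) n) {..<CARD('p) ^ n} {0..<int CARD('p) ^ n}"
    (is "bij_betw ?g ?A ?C")
proof -
  have img: "?g ` ?A = ?C"
  proof (intro equalityI subsetI)
    fix a assume "a \<in> ?g ` ?A"
    then show "a \<in> ?C" using padic_residue_nonneg padic_residue_less by auto
  next
    fix a assume a: "a \<in> ?C"
    have "{x. padic_residue x n = a} \<in> sets \<mu>"
      using haar borel_open[OF open_padic_cylinder] by (simp add: normalized_haar_measure_def)
    then have "emeasure \<mu> (f -` {x. padic_residue x n = a} \<inter> space \<mu>) \<noteq> 0"
      using mp normalized_haar_measure_cylinder_neq_0[OF haar, of a n] a
      unfolding measure_preserving_map_def by (metis atLeastLessThan_iff)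
    then have "f -` {x. padic_residue x n = a} \<inter> space \<mu> \<noteq> {}" by auto
    then obtain x where x: "padic_residue (f x) n = a" by auto
    let ?k = "nat (padic_residue x n)"
    have "int ?k < int (CARD('p) ^ n)"
      using padic_residue_nonneg[of x n] padic_residue_less[of x n] by simp
    then have "?k \<in> ?A" by (simp only: of_nat_less_iff lessThan_iff)
    moreover have "padic_residue (of_nat ?k :: 'p padic_int) n = padic_residue x n"
      using padic_residue_nonneg[of x n] unfolding padic_residue_of_nat by (simp add: padic_residue_mod_self)
    then have "a = ?g ?k"
      using lipschitz_padic_residue_cong[OF lip] x by metis
    ultimately show "a \<in> ?g ` ?A" by (rule rev_image_eqI)
  qed
  moreover have "card ?C = card ?A" by (simp add: nat_power_eq)
  ultimately show ?thesis by (metis bij_betw_def eq_card_imp_inj_on finite_lessThan)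
qed

section \<open>Values of the van der Put basis and its coefficients\<close>

lemma van_der_put_of_nat:
  assumes "k \<noteq> 0" and k: "CARD('p) ^ l \<le> k" "k < CARD('p) ^ Suc l"
  shows "(van_der_put k (of_nat m) :: 'p :: prime_card padic_int)
       = (if m mod CARD('p) ^ Suc l = k then 1 else 0)"
proof -
  let ?q = "CARD('p)"
  \<comment> \<open>The ball around \<open>k\<close> therefore has radius
    \<open>p ^ -(l + 1)\<close>: it is a residue class modulo \<open>p ^ (l + 1)\<close>, with least
    element \<open>k\<close> among the naturals.\<close>
  have "\<lfloor>log (real ?q) (real k)\<rfloor> = int l"
    using floor_log_nat_eq_if[of ?q l k] k CARD_prime_card_gt_1[where 'p = 'p] by simp
  then have *: "- \<lfloor>log (real ?q) (real k)\<rfloor> - 1 = - int (Suc l)" by simp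
  have "padic_residue (of_nat m - of_nat k :: 'p padic_int) (Suc l) = 0
      \<longleftrightarrow> int m mod int ?q ^ Suc l = int k mod int ?q ^ Suc l"
    by (simp only: padic_residue_diff_eq_0_iff padic_residue_of_nat)
  also have "\<dots> \<longleftrightarrow> m mod ?q ^ Suc l = k"
    using k(2) by (metis mod_less of_nat_eq_iff of_nat_power zmod_int)
  finally show ?thesis
    using assms(1) unfolding van_der_put_def * padic_abs_le_iff by simp
qed

lemma van_der_put_0_of_nat:
  "(van_der_put 0 (of_nat m) :: 'p :: prime_card padic_int) = (if m mod CARD('p) = 0 then 1 else 0)"
proof -
  have "int m mod int CARD('p) = 0 \<longleftrightarrow> m mod CARD('p) = 0"
    by (metis of_nat_eq_0_iff zmod_int)
  then show ?thesis
    using padic_abs_le_iff[of "of_nat m :: 'p padic_int" 1]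
    by (simp add: van_der_put_def padic_residue_of_nat)
qed

text \<open>Compare the expansions at \<open>m\<close> and at its remainder modulo
  \<open>p ^ l\<close>. Basis functions of index below \<open>p ^ l\<close> do not separate the two
  points, those of index from \<open>p ^ l\<close> to \<open>m - 1\<close> vanish at both, and those
  of index above \<open>m\<close> vanish as well. Only the term of index \<open>m\<close>
  survives.\<close>

lemma van_der_put_coeff:
  fixes f :: "'p :: prime_card padic_int \<Rightarrow> 'p padic_int"
  assumes expansion: "\<And>x. (\<lambda>m. B m * van_der_put m x) sums f x"
    and l: "0 < l" and m: "CARD('p) ^ l \<le> m" "m < CARD('p) ^ Suc l"
  shows "B m = f (of_nat m) - f (of_nat (m mod CARD('p) ^ l))"
proof -
  let ?q = "CARD('p)" and ?v = "van_der_put :: nat \<Rightarrow> 'p padic_int \<Rightarrow> 'p padic_int"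
  have q1: "1 < ?q" by (rule CARD_prime_card_gt_1)
  have log: "\<exists>i. ?q ^ i \<le> k \<and> k < ?q ^ Suc i" if "k \<noteq> 0" for k
    using ex_power_ivl1[of ?q k] q1 that by auto
  \<comment> \<open>A remainder of \<open>j\<close> is at most \<open>j\<close>, so it never equals
    an index \<open>k > j\<close>; the series at \<open>j\<close> is finite.\<close>
  have fin: "f (of_nat j) = (\<Sum>k\<le>m. B k * ?v k (of_nat j))" if "j \<le> m" for j
  proof (rule sums_unique2[OF expansion], rule sums_finite)
    fix k assume "k \<notin> {..m}"
    then have "j < k" using that by simp
    obtain i where i: "?q ^ i \<le> k" "k < ?q ^ Suc i" using log[of k] \<open>j < k\<close> by auto
    then show "B k * ?v k (of_nat j) = 0"
      using \<open>j < k\<close> by (simp add: van_der_put_of_nat[OF _ i] del: power_Suc)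
  qed simp
  let ?m' = "m mod ?q ^ l"
  have "?m' < ?q ^ l" using q1 by simp
  have eq: "?v k (of_nat m) = ?v k (of_nat ?m')" if "k < m" for k
  proof (cases "k = 0")
    case True
    have "?m' mod ?q = m mod ?q" using l by (simp add: mod_mod_cancel)
    then show ?thesis using True by (simp add: van_der_put_0_of_nat)
  next
    case False
    then obtain i where i: "?q ^ i \<le> k" "k < ?q ^ Suc i" using log by blast
    show ?thesis
    proof (cases "i < l")
      case True
      then have "?q ^ Suc i dvd ?q ^ l" by (simp add: le_imp_power_dvd Suc_leI del: power_Suc)
      then show ?thesis using False by (simp add: van_der_put_of_nat[OF _ i] mod_mod_cancel del: power_Suc)
    next
      case ge: False
      \<comment> \<open>Now \<open>k\<close> is at least \<open>p ^ l\<close>. Both points are their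
        own remainders modulo \<open>p ^ (i + 1)\<close>, and \<open>k\<close> lies strictly between
        them.\<close>
      have le: "?q ^ l \<le> ?q ^ i" "?q ^ Suc l \<le> ?q ^ Suc i"
        using ge q1 by (simp_all add: power_increasing del: power_Suc)
      have "m mod ?q ^ Suc i = m" using m le by (intro mod_less) linarith
      moreover have "?m' mod ?q ^ Suc i = ?m'"
        using \<open>?m' < ?q ^ l\<close> le m by (intro mod_less) linarith
      moreover have "?m' < k" using \<open>?m' < ?q ^ l\<close> le(1) i(1) by linarith
      ultimately show ?thesis
        using \<open>k < m\<close> unfolding van_der_put_of_nat[OF False i] by simp
    qed
  qed
  have "m \<noteq> 0" using m(1) q1 by (metis le_zero_eq not_one_less_zero power_eq_0_iff)
  have "f (of_nat m) - f (of_nat ?m') = (\<Sum>k\<le>m. B k * (?v k (of_nat m) - ?v k (of_nat ?m')))"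
    by (simp add: fin sum_subtractf right_diff_distrib)
  also have "\<dots> = (\<Sum>k\<in>{m}. B k * (?v k (of_nat m) - ?v k (of_nat ?m')))"
    using eq by (intro sum.mono_neutral_right) (auto simp: le_less)
  also have "\<dots> = B m * (?v m (of_nat m) - ?v m (of_nat ?m'))" by simp
  also have "\<dots> = B m"
  proof -
    have "?m' < ?q ^ Suc l" using \<open>?m' < ?q ^ l\<close> m by linarith
    then have "?m' mod ?q ^ Suc l \<noteq> m" using \<open>?m' < ?q ^ l\<close> m(1) by (metis leD mod_less)
    then show ?thesis
      using m unfolding van_der_put_of_nat[OF \<open>m \<noteq> 0\<close> m] by (simp del: power_Suc)
  qed
  finally show ?thesis by simp
qed

section \<open>Elementary sums\<close>

lemma sum_blocks:
  fixes g :: "nat \<Rightarrow> 'a :: comm_monoid_add"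
  assumes "0 < N"
  shows "(\<Sum>m = N..<q * N. g m) = (\<Sum>a<N. \<Sum>j = 1..<q. g (a + j * N))"
  unfolding sum.cartesian_product
\<comment> \<open>Division with remainder by \<open>N\<close>. For \<open>N = p ^ l\<close> and
  \<open>q = p\<close> the quotient \<open>j\<close> is the leading digit of \<open>m\<close>,
  nonzero because \<open>m\<close> is at least \<open>N\<close>.\<close>
proof (rule sum.reindex_bij_witness[where i = "\<lambda>(a, j). a + j * N" and j = "\<lambda>m. (m mod N, m div N)"])
  fix m assume "m \<in> {N..<q * N}"
  then show "(m mod N, m div N) \<in> {..<N} \<times> {1..<q}"
    using assms by (auto simp: less_mult_imp_div_less Suc_le_eq div_greater_zero_iff)
next
  fix z assume z: "z \<in> {..<N} \<times> {1..<q}"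
  then obtain a j where aj: "z = (a, j)" "a < N" "1 \<le> j" "j < q" by auto
  have "a + j * N < Suc j * N" using aj by simp
  also have "\<dots> \<le> q * N" using aj by (intro mult_right_mono) auto
  finally show "(case z of (a, j) \<Rightarrow> a + j * N) \<in> {N..<q * N}"
    using aj by (auto intro: trans_le_add2)
  show "((case z of (a, j) \<Rightarrow> a + j * N) mod N, (case z of (a, j) \<Rightarrow> a + j * N) div N) = z"
    using aj by simp
qed auto

text \<open>For positive \<open>n\<close> the product contains two consecutive integers
  \<open>q - 1\<close> and \<open>q\<close>, so the halving in \<open>e\<close> is exact, also for
  even \<open>q\<close>.\<close>

lemma two_times_power_times_pred_div_2:
  assumes "0 < (n :: nat)"
  shows "2 * (q ^ n * (q - 1) div 2) = q ^ n * (q - 1 :: int)"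
  using assms by (intro dvd_mult_div_cancel) auto

lemma sum_atLeast0_int: "0 \<le> k \<Longrightarrow> 2 * \<Sum>{0..<k} = k * (k - 1 :: int)"
proof (induction k rule: int_ge_induct)
  case (step k)
  have "{0..<k + 1} = insert k {0..<k}" using step by auto
  then show ?case using step by (simp add: algebra_simps)
qed simp

text \<open>Each term is replaced by its residue modulo \<open>p ^ (n + 1)\<close>, from which the
  top digit is split off. This is where digit sums enter: \<open>S n\<close> from the values of
  \<open>f\<close>, and \<open>T\<close> from the \<open>b m\<close> with
  \<open>n = 1\<close>.\<close>

lemma sum_padic_cong_residue_sum:
  fixes g :: "nat \<Rightarrow> 'p :: prime_card padic_int"
  shows "of_nat CARD('p) ^ Suc n dvd (\<Sum>m\<in>A. g m)
    - of_int ((\<Sum>m\<in>A. padic_residue (g m) n) + int CARD('p) ^ n * int (\<Sum>m\<in>A. padic_digit (g m) n))"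
proof -
  have "(\<Sum>m\<in>A. padic_residue (g m) n) + int CARD('p) ^ n * int (\<Sum>m\<in>A. padic_digit (g m) n)
      = (\<Sum>m\<in>A. padic_residue (g m) (Suc n))"
    by (simp add: padic_residue_Suc sum.distrib sum_distrib_left mult.commute)
  then have "(\<Sum>m\<in>A. g m) - of_int ((\<Sum>m\<in>A. padic_residue (g m) n)
      + int CARD('p) ^ n * int (\<Sum>m\<in>A. padic_digit (g m) n))
    = (\<Sum>m\<in>A. g m - of_int (padic_residue (g m) (Suc n)))"
    by (simp add: sum_subtractf)
  then show ?thesis by (simp only: dvd_sum padic_power_dvd_diff_residue)
qed

section \<open>Congruences for the sums of values and coefficients\<close>

lemma sum_measure_preserving_cong:
  fixes f :: "'p :: prime_card padic_int \<Rightarrow> 'p padic_int"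
  assumes "normalized_haar_measure \<mu>" "measure_preserving_map \<mu> f" "1-lipschitz_on UNIV f"
  shows "of_nat CARD('p) ^ Suc n dvd (\<Sum>m<CARD('p) ^ n. f (of_nat m))
    - of_int (\<Sum>{0..<int CARD('p) ^ n}
        + int CARD('p) ^ n * int (\<Sum>m<CARD('p) ^ n. padic_digit (f (of_nat m)) n))"
  using sum_padic_cong_residue_sum[of n "\<lambda>m. f (of_nat m)" "{..<CARD('p) ^ n}"]
    sum.reindex_bij_betw[OF measure_preserving_bij_betw_residues[OF assms, of n], of "\<lambda>x. x"]
  by simp

lemma sum_van_der_put_coeffs_cong:
  fixes f :: "'p :: prime_card padic_int \<Rightarrow> 'p padic_int"
  assumes f: "normalized_haar_measure \<mu>" "measure_preserving_map \<mu> f" "1-lipschitz_on UNIV f"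
    and expansion: "\<And>x. (\<lambda>m. B m * van_der_put m x) sums f x" and l: "0 < l"
  defines "q \<equiv> CARD('p)"
  defines "S \<equiv> \<lambda>n. \<Sum>m<q ^ n. padic_digit (f (of_nat m)) n"
  shows "of_nat q ^ (l + 2) dvd (\<Sum>m = q ^ l..<q ^ Suc l. B m)
    - of_int (int q ^ Suc l * (int (S (Suc l)) - int (S l) + int q ^ l * (int q - 1) div 2))"
proof -
  define F where "F n = (\<Sum>m<q ^ n. f (of_nat m))" for n
  define G where "G n = \<Sum>{0..<int q ^ n} + int q ^ n * int (S n)" for n
  have q1: "1 < q" unfolding q_def by (rule CARD_prime_card_gt_1)
  have le: "q ^ l \<le> q ^ Suc l" using q1 by simp
  have F: "of_nat q ^ Suc n dvd F n - of_int (G n)" for n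
    unfolding F_def G_def S_def q_def by (rule sum_measure_preserving_cong[OF f])
  have "(\<Sum>m = q ^ l..<q ^ Suc l. B m)
      = (\<Sum>m = q ^ l..<q ^ Suc l. f (of_nat m) - f (of_nat (m mod q ^ l)))"
    using van_der_put_coeff[OF expansion l, folded q_def] by (intro sum.cong) auto
  \<comment> \<open>Each \<open>a\<close> below \<open>q ^ l\<close> is the remainder of exactly
    \<open>q - 1\<close> indices \<open>m\<close>, one for each nonzero leading digit.\<close>
  also have "\<dots> = (\<Sum>m = q ^ l..<q ^ Suc l. f (of_nat m)) - (\<Sum>a<q ^ l. \<Sum>j = 1..<q. f (of_nat a))"
    using q1 by (simp add: sum_subtractf sum_blocks[of "q ^ l" "\<lambda>m. f (of_nat (m mod q ^ l))" q] del: of_nat_add)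
  also have "(\<Sum>m = q ^ l..<q ^ Suc l. f (of_nat m)) = F (Suc l) - F l"
    unfolding F_def lessThan_atLeast0
    by (subst sum.atLeastLessThan_concat[OF _ le, symmetric, of 0]) auto
  also have "(\<Sum>a<q ^ l. \<Sum>j = 1..<q. f (of_nat a)) = (of_nat q - 1) * F l"
    using q1 by (simp add: F_def sum_distrib_left of_nat_diff)
  finally have B: "(\<Sum>m = q ^ l..<q ^ Suc l. B m) = F (Suc l) - of_nat q * F l"
    by (simp only: left_diff_distrib mult_1_left) simp
  \<comment> \<open>\<open>F l\<close> is controlled only modulo \<open>q ^ (l + 1)\<close>; the
    factor \<open>q\<close> in front of it supplies the missing power.\<close>
  have "of_nat q ^ (l + 2) dvd (F (Suc l) - of_int (G (Suc l))) - of_nat q * (F l - of_int (G l))"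
    using F[of "Suc l"] mult_dvd_mono[OF dvd_refl F[of l], of "of_nat q"] by (simp add: dvd_diff)
  also have "\<dots> = (\<Sum>m = q ^ l..<q ^ Suc l. B m) - of_int (G (Suc l) - int q * G l)"
    unfolding B by (simp add: algebra_simps)
  also have "G (Suc l) - int q * G l
      = int q ^ Suc l * (int (S (Suc l)) - int (S l) + int q ^ l * (int q - 1) div 2)"
  proof -
    have nn: "0 \<le> int q ^ k" for k by simp
    \<comment> \<open>Doubling clears the halves:
      \<open>q ^ (l + 1) * (q ^ (l + 1) - 1) - q ^ (l + 1) * (q ^ l - 1)\<close> is
      \<open>q ^ (l + 1)\<close> times \<open>q ^ l * (q - 1)\<close>.\<close>
    have "2 * (G (Suc l) - int q * G l)
        = 2 * \<Sum>{0..<int q ^ Suc l} - int q * (2 * \<Sum>{0..<int q ^ l})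
          + 2 * int q ^ Suc l * (int (S (Suc l)) - int (S l))"
      unfolding G_def by (simp add: algebra_simps)
    also have "\<dots> = int q ^ Suc l * (2 * (int q ^ l * (int q - 1) div 2))
        + 2 * int q ^ Suc l * (int (S (Suc l)) - int (S l))"
      unfolding sum_atLeast0_int[OF nn] two_times_power_times_pred_div_2[OF l] by (simp add: algebra_simps)
    also have "\<dots> = 2 * (int q ^ Suc l * (int (S (Suc l)) - int (S l) + int q ^ l * (int q - 1) div 2))"
      by (simp only: algebra_simps)
    finally show ?thesis by simp
  qed
  finally show ?thesis .
qed

text \<open>Fix the class \<open>a\<close> modulo \<open>p ^ l\<close>. Since \<open>f\<close> is
  injective modulo \<open>p ^ (l + 1)\<close>, the quotients of
  \<open>f (a + j * p ^ l) - f a\<close> by \<open>p ^ l\<close> are distinct modulo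
  \<open>p\<close> for \<open>j < p\<close>, hence form a complete residue system. So the residues
  modulo \<open>p\<close> in every class have the same known sum.\<close>

lemma sum_reduced_coeffs_cong:
  fixes f :: "'p :: prime_card padic_int \<Rightarrow> 'p padic_int"
  assumes f: "normalized_haar_measure \<mu>" "measure_preserving_map \<mu> f" "1-lipschitz_on UNIV f"
    and expansion: "\<And>x. (\<lambda>m. B m * van_der_put m x) sums f x" and l: "0 < l"
  defines "q \<equiv> CARD('p)"
  assumes b: "\<And>m. m \<in> {q ^ l..<q ^ Suc l} \<Longrightarrow> B m = of_nat q ^ l * b m"
  shows "of_nat q ^ 2 dvd (\<Sum>m = q ^ l..<q ^ Suc l. b m)
    - of_int (int q * (int (\<Sum>m = q ^ l..<q ^ Suc l. padic_digit (b m) 1) + int q ^ l * (int q - 1) div 2))"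
proof -
  let ?N = "q ^ l"
  let ?r = "\<lambda>x :: 'p padic_int. padic_residue x 1"
  have q1: "1 < q" unfolding q_def by (rule CARD_prime_card_gt_1)
  have inj: "inj_on (\<lambda>k. padic_residue (f (of_nat k)) (Suc l)) {..<q ^ Suc l}"
    using measure_preserving_bij_betw_residues[OF f] unfolding q_def by (rule bij_betw_imp_inj_on)
  have block: "(\<Sum>j = 1..<q. ?r (b (a + j * ?N))) = \<Sum>{0..<int q}" if a: "a < ?N" for a
  proof -
    \<comment> \<open>The value 0 at \<open>j = 0\<close> belongs to the difference of
      \<open>f a\<close> with itself. It completes the family to \<open>q\<close> members, as
      counting requires, and adds nothing to the sum.\<close>
    define c where "c j = (if j = 0 then 0 else b (a + j * ?N))" for j
    have less: "a + j * ?N < q ^ Suc l" if "j < q" for j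
    proof -
      have "a + j * ?N < Suc j * ?N" using a by simp
      also have "\<dots> \<le> q * ?N" using that by (intro mult_right_mono) auto
      finally show ?thesis by simp
    qed
    have c: "f (of_nat (a + j * ?N)) - f (of_nat a) = of_nat q ^ l * c j" if "j < q" for j
    proof (cases "j = 0")
      case False
      then have ge: "?N \<le> a + j * ?N" by (cases j) auto
      have "(a + j * ?N) mod ?N = a" using a by simp
      then show ?thesis
        using van_der_put_coeff[OF expansion l, of "a + j * ?N", folded q_def] ge less[OF that] b False
        by (auto simp: c_def simp del: of_nat_add)
    qed (simp add: c_def)
    have inj_c: "inj_on (\<lambda>j. ?r (c j)) {..<q}"
    proof (rule inj_onI)
      fix i j assume ij: "i \<in> {..<q}" "j \<in> {..<q}" "?r (c i) = ?r (c j)"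
      then have "of_nat q ^ 1 dvd c i - c j"
        unfolding q_def by (subst padic_power_dvd_diff_iff)
      then have "of_nat q ^ (l + 1) dvd of_nat q ^ l * (c i - c j)"
        by (simp only: padic_power_add_dvd_iff q_def)
      also have "of_nat q ^ l * (c i - c j) = f (of_nat (a + i * ?N)) - f (of_nat (a + j * ?N))"
        using c[of i] c[of j] ij by (simp add: right_diff_distrib del: of_nat_add flip: c)
      finally have "padic_residue (f (of_nat (a + i * ?N))) (Suc l)
          = padic_residue (f (of_nat (a + j * ?N))) (Suc l)"
        unfolding q_def padic_power_dvd_diff_iff by simp
      then have "a + i * ?N = a + j * ?N"
        using inj_onD[OF inj] less ij(1,2) by (metis lessThan_iff)
      then show "i = j" using q1 by simp
    qed
    have "(\<lambda>j. ?r (c j)) ` {..<q} \<subseteq> {0..<int q}"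
      using padic_residue_nonneg padic_residue_less[where n = 1, where 'p = 'p] by (auto simp: q_def)
    moreover have "card ((\<lambda>j. ?r (c j)) ` {..<q}) = card {0..<int q}"
      using card_image[OF inj_c] by simp
    ultimately have img: "(\<lambda>j. ?r (c j)) ` {..<q} = {0..<int q}"
      by (intro card_subset_eq) auto
    have "(\<Sum>j = 1..<q. ?r (b (a + j * ?N))) = (\<Sum>j = 1..<q. ?r (c j))"
      by (intro sum.cong) (auto simp: c_def)
    also have "\<dots> = (\<Sum>j<q. ?r (c j))"
      by (intro sum.mono_neutral_left) (auto simp: c_def zero_padic_int.rep_eq)
    also have "\<dots> = \<Sum>{0..<int q}"
      using sum.reindex[OF inj_c, of "\<lambda>x. x"] img by simp
    finally show ?thesis .
  qed
  have "(\<Sum>m = ?N..<q ^ Suc l. ?r (b m)) = int ?N * \<Sum>{0..<int q}"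
    using sum_blocks[of ?N "\<lambda>m. ?r (b m)" q] block q1 by simp
  also have "\<dots> = int q * (int q ^ l * (int q - 1) div 2)"
  proof -
    have "2 * (int ?N * \<Sum>{0..<int q}) = int q * (2 * (int q ^ l * (int q - 1) div 2))"
      using sum_atLeast0_int[of "int q"] two_times_power_times_pred_div_2[OF l, of "int q"]
      by (simp add: mult.left_commute)
    then show ?thesis by simp
  qed
  finally show ?thesis
    using sum_padic_cong_residue_sum[of 1 b "{?N..<q ^ Suc l}"]
    by (simp add: q_def numeral_2_eq_2 algebra_simps)
qed

text \<open>The first equivalence cancels \<open>p ^ (n - 1)\<close>; the others insert the two
  congruences for the sums and cancel further powers of \<open>p\<close>. Keeping \<open>e\<close>
  in the formulas lets one statement serve the exceptional case \<open>p = n = 2\<close>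
  too.\<close>

lemma sum_van_der_put_coeffs_equivalences:
  fixes f :: "'p :: prime_card padic_int \<Rightarrow> 'p padic_int"
  assumes f: "normalized_haar_measure \<mu>" "measure_preserving_map \<mu> f" "1-lipschitz_on UNIV f"
    and expansion: "\<And>x. (\<lambda>m. B m * van_der_put m x) sums f x"
    and p: "p = CARD('p)" and n: "2 \<le> n"
    and b: "\<And>m. m \<in> {p ^ (n - 1)..p ^ n - 1} \<Longrightarrow> B m = of_nat p ^ (n - 1) * b m"
    and T: "T = (\<Sum>m = p ^ (n - 1)..p ^ n - 1. padic_digit (b m) 1)"
    and S: "\<And>n. 1 \<le> n \<Longrightarrow> S n = (\<Sum>m = 0..p ^ n - 1. padic_digit (f (of_nat m)) n)"
    and e: "e = int p ^ (n - 1) * (int p - 1) div 2"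
  shows "of_nat p ^ (n + 1) dvd (\<Sum>m = p ^ (n - 1)..p ^ n - 1. B m) - of_int r * of_nat p ^ n
      \<longleftrightarrow> of_nat p ^ 2 dvd (\<Sum>m = p ^ (n - 1)..p ^ n - 1. b m) - of_int r * of_nat p" (is ?BB)
    and "of_nat p ^ 2 dvd (\<Sum>m = p ^ (n - 1)..p ^ n - 1. b m) - of_int r * of_nat p
      \<longleftrightarrow> [int (S n) + e = int (S (n - 1)) + r] (mod int p)" (is ?bS)
    and "[int (S n) + e = int (S (n - 1)) + r] (mod int p) \<longleftrightarrow> [int T + e = r] (mod int p)" (is ?ST)
proof -
  obtain l where l: "n = Suc l" "0 < l" using n by (cases n) auto
  have q1: "1 < p" unfolding p by (rule CARD_prime_card_gt_1)
  have ivl: "{a..p ^ k - 1} = {a..<p ^ k}" for a k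
    using q1 by (metis Suc_diff_1 atLeastLessThanSuc_atLeastAtMost less_trans zero_less_one zero_less_power)
  let ?D = "{p ^ l..<p ^ Suc l}"
  have S': "S k = (\<Sum>m<p ^ k. padic_digit (f (of_nat m)) k)" if "1 \<le> k" for k
    using S[OF that] by (simp only: ivl lessThan_atLeast0)
  have b': "B m = of_nat p ^ l * b m" if "m \<in> ?D" for m
    using b[of m] that by (simp only: ivl l diff_Suc_1)
  have T': "T = (\<Sum>m\<in>?D. padic_digit (b m) 1)"
    unfolding T ivl l(1) diff_Suc_1 ..
  have e': "e = int p ^ l * (int p - 1) div 2" using e l(1) by simp
  have "of_nat p ^ (l + 2) dvd sum B ?D
      - of_int (int p ^ Suc l * (int (S (Suc l)) - int (S l) + e))"
    using sum_van_der_put_coeffs_cong[OF f expansion l(2)] l(2)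
    unfolding e' by (simp only: S' p One_nat_def Suc_le_eq zero_less_Suc)
  then have BS: "of_nat p ^ (l + 2) dvd sum B ?D - of_int (r * int p ^ Suc l)
      \<longleftrightarrow> int p ^ (l + 2) dvd int p ^ Suc l * (int (S (Suc l)) - int (S l) + e) - r * int p ^ Suc l"
    unfolding p by (rule padic_dvd_cong_of_int)
  have "of_nat p ^ 2 dvd sum b ?D - of_int (int p * (int T + e))"
    using sum_reduced_coeffs_cong[OF f expansion l(2) b'[unfolded p]]
    unfolding e' T' by (simp only: p)
  then have bT: "of_nat p ^ 2 dvd sum b ?D - of_int (r * int p)
      \<longleftrightarrow> int p ^ 2 dvd int p * (int T + e) - r * int p"
    unfolding p by (rule padic_dvd_cong_of_int)
  have "sum B ?D - of_int (r * int p ^ Suc l) = of_nat p ^ l * (sum b ?D - of_int (r * int p))"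
    using b' by (simp add: sum_distrib_left algebra_simps)
  then have Bb: "of_nat p ^ (l + 2) dvd sum B ?D - of_int (r * int p ^ Suc l)
      \<longleftrightarrow> of_nat p ^ 2 dvd sum b ?D - of_int (r * int p)"
    by (simp only: p padic_power_add_dvd_iff)
  have "int p ^ Suc l * (int (S (Suc l)) - int (S l) + e) - r * int p ^ Suc l
      = int p ^ Suc l * ((int (S (Suc l)) + e) - (int (S l) + r))"
    by (simp add: algebra_simps)
  moreover have "int p ^ (l + 2) = int p ^ Suc l * int p" by simp
  ultimately have S_iff: "int p ^ (l + 2) dvd int p ^ Suc l * (int (S (Suc l)) - int (S l) + e) - r * int p ^ Suc l
      \<longleftrightarrow> [int (S (Suc l)) + e = int (S l) + r] (mod int p)"
    using q1 by (simp only: dvd_mult_cancel_left cong_iff_dvd_diff) simp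
  have "int p * (int T + e) - r * int p = int p * ((int T + e) - r)"
    by (simp add: algebra_simps)
  then have T_iff: "int p ^ 2 dvd int p * (int T + e) - r * int p \<longleftrightarrow> [int T + e = r] (mod int p)"
    using q1 by (simp only: dvd_mult_cancel_left cong_iff_dvd_diff power2_eq_square) simp
  \<comment> \<open>The conditions on \<open>S\<close> and \<open>T\<close> are never compared
    directly: the first is tied to the sum of the \<open>B m\<close>, the second to that of the
    \<open>b m\<close>, and \<open>Bb\<close> joins them.\<close>
  show ?BB ?bS ?ST
    using Bb BS bT S_iff T_iff unfolding ivl l(1) by simp_all
qed

theorem theorem3p10:
  fixes p :: nat
    and \<mu> :: "'p :: prime_card padic_int measure"
    and f :: "'p padic_int \<Rightarrow> 'p padic_int"
    and B b :: "nat \<Rightarrow> 'p padic_int"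
    and S T :: "nat \<Rightarrow> nat"
    and r :: int
  assumes p: "p = CARD('p)"
    and haar: "normalized_haar_measure \<mu>"
    and preserving: "measure_preserving_map \<mu> f"
    and lipschitz: "1-lipschitz_on UNIV f"
    and expansion: "\<And>x. (\<lambda>m. B m * van_der_put m x) sums f x"
    and b: "\<And>n m. 2 \<le> n \<Longrightarrow> m \<in> {p ^ (n - 1)..p ^ n - 1} \<Longrightarrow> B m = of_nat p ^ (n - 1) * b m"
    and T: "\<And>n. 2 \<le> n \<Longrightarrow> T n = (\<Sum>m = p ^ (n - 1)..p ^ n - 1. padic_digit (b m) 1)"
    and S: "\<And>n. 1 \<le> n \<Longrightarrow> S n = (\<Sum>m = 0..p ^ n - 1. padic_digit (f (of_nat m)) n)"
  shows
    "(p = 2 \<longrightarrow>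
        ((2 ^ 3 dvd (\<Sum>m = 2..3. B m) - 4 \<longleftrightarrow> 2 ^ 2 dvd (\<Sum>m = 2..3. b m) - 2) \<and>
         (2 ^ 2 dvd (\<Sum>m = 2..3. b m) - 2 \<longleftrightarrow> [S 2 = S 1] (mod 2)) \<and>
         ([S 2 = S 1] (mod 2) \<longleftrightarrow> [T 2 = 0] (mod 2))) \<and>
        ((2 ^ 3 dvd (\<Sum>m = 2..3. B m) \<longleftrightarrow> 2 ^ 2 dvd (\<Sum>m = 2..3. b m)) \<and>
         (2 ^ 2 dvd (\<Sum>m = 2..3. b m) \<longleftrightarrow> [S 2 = S 1 + 1] (mod 2)) \<and>
         ([S 2 = S 1 + 1] (mod 2) \<longleftrightarrow> [T 2 = 1] (mod 2)))) \<and>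
     (p > 2 \<longrightarrow>
        (of_nat p ^ 3 dvd (\<Sum>m = p..p ^ 2 - 1. B m) - of_int r * of_nat p ^ 2 \<longleftrightarrow>
         of_nat p ^ 2 dvd (\<Sum>m = p..p ^ 2 - 1. b m) - of_int r * of_nat p) \<and>
        (of_nat p ^ 2 dvd (\<Sum>m = p..p ^ 2 - 1. b m) - of_int r * of_nat p \<longleftrightarrow>
         [int (S 2) = int (S 1) + r] (mod int p)) \<and>
        ([int (S 2) = int (S 1) + r] (mod int p) \<longleftrightarrow> [int (T 2) = r] (mod int p))) \<and>
     (\<forall>n\<ge>3.
        (of_nat p ^ (n + 1) dvd (\<Sum>m = p ^ (n - 1)..p ^ n - 1. B m) - of_int r * of_nat p ^ n \<longleftrightarrow>
         of_nat p ^ 2 dvd (\<Sum>m = p ^ (n - 1)..p ^ n - 1. b m) - of_int r * of_nat p) \<and>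
        (of_nat p ^ 2 dvd (\<Sum>m = p ^ (n - 1)..p ^ n - 1. b m) - of_int r * of_nat p \<longleftrightarrow>
         [int (S n) = int (S (n - 1)) + r] (mod int p)) \<and>
        ([int (S n) = int (S (n - 1)) + r] (mod int p) \<longleftrightarrow> [int (T n) = r] (mod int p)))"
proof -
  define e where "e n = int p ^ (n - 1) * (int p - 1) div 2" for n
  let ?B = "\<lambda>n r. of_nat p ^ (n + 1) dvd (\<Sum>m = p ^ (n - 1)..p ^ n - 1. B m) - of_int r * of_nat p ^ n"
  let ?b = "\<lambda>n r. of_nat p ^ 2 dvd (\<Sum>m = p ^ (n - 1)..p ^ n - 1. b m) - of_int r * of_nat p"
  \<comment> \<open>Here \<open>r\<close> is a fresh variable, because the case \<open>p = 2\<close>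
    needs the values 1 and 0.\<close>
  have eqv: "(?B n r \<longleftrightarrow> ?b n r)
      \<and> (?b n r \<longleftrightarrow> [int (S n) + e n = int (S (n - 1)) + r] (mod int p))
      \<and> ([int (S n) + e n = int (S (n - 1)) + r] (mod int p) \<longleftrightarrow> [int (T n) + e n = r] (mod int p))"
    if "2 \<le> n" for n r
    by (intro conjI sum_van_der_put_coeffs_equivalences[OF haar preserving lipschitz
          expansion p that b[OF that] T[OF that] S e_def])
  \<comment> \<open>If \<open>p\<close> is odd, \<open>(p - 1) / 2\<close> is an integer and
    \<open>p ^ (n - 1)\<close> divides \<open>e n\<close>. If \<open>p = 2\<close>, then
    \<open>e n = 2 ^ (n - 2)\<close>, which is even from \<open>n = 3\<close> on.\<close>
  have e0: "int p dvd e n" if "2 \<le> n" "p \<noteq> 2 \<or> 3 \<le> n" for n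
  proof (cases "p = 2")
    case True
    then have "3 \<le> n" using that by simp
    then obtain k where "n = 3 + k" by (blast dest: le_Suc_ex)
    then show ?thesis using True by (simp add: e_def)
  next
    case False
    have "prime p" unfolding p by (rule prime_card)
    then have "odd p" using False prime_odd_nat[of p] prime_ge_2_nat[of p] by linarith
    then have "even (int p - 1)" by simp
    then obtain k where "int p - 1 = 2 * k" by (rule evenE)
    then have "e n = int p ^ (n - 1) * k" by (simp add: e_def)
    then show ?thesis using that by simp
  qed
  have main: "(?B n r \<longleftrightarrow> ?b n r)
      \<and> (?b n r \<longleftrightarrow> [int (S n) = int (S (n - 1)) + r] (mod int p))
      \<and> ([int (S n) = int (S (n - 1)) + r] (mod int p) \<longleftrightarrow> [int (T n) = r] (mod int p))"
    if "2 \<le> n" "p \<noteq> 2 \<or> 3 \<le> n" for n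
  proof -
    have drop: "[x + e n = y] (mod int p) \<longleftrightarrow> [x = y] (mod int p)" for x y
      using e0[OF that] by (auto simp: cong_def dvd_eq_mod_eq_0 mod_add_right_eq[of x "e n", symmetric])
    show ?thesis using eqv[OF that(1), of r] unfolding drop .
  qed
  have case_2:
    "   ((2 ^ 3 dvd (\<Sum>m = 2..3. B m) - 4 \<longleftrightarrow> 2 ^ 2 dvd (\<Sum>m = 2..3. b m) - 2) \<and>
         (2 ^ 2 dvd (\<Sum>m = 2..3. b m) - 2 \<longleftrightarrow> [S 2 = S 1] (mod 2)) \<and>
         ([S 2 = S 1] (mod 2) \<longleftrightarrow> [T 2 = 0] (mod 2))) \<and>
        ((2 ^ 3 dvd (\<Sum>m = 2..3. B m) \<longleftrightarrow> 2 ^ 2 dvd (\<Sum>m = 2..3. b m)) \<and>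
         (2 ^ 2 dvd (\<Sum>m = 2..3. b m) \<longleftrightarrow> [S 2 = S 1 + 1] (mod 2)) \<and>
         ([S 2 = S 1 + 1] (mod 2) \<longleftrightarrow> [T 2 = 1] (mod 2)))" if "p = 2"
  proof -
    \<comment> \<open>The correction 1 shifts the classes modulo 2: \<open>r = 1\<close> (sums 4 and
      2) leads to \<open>S 2 = S 1\<close> and \<open>T 2 = 0\<close>, while \<open>r = 0\<close>
      leads to \<open>S 2 = S 1 + 1\<close> and \<open>T 2 = 1\<close>.\<close>
    have e: "e 2 = 1" using that by (simp add: e_def)
    have "[int (S 2) + 1 = int (S 1) + 1] (mod 2) \<longleftrightarrow> [S 2 = S 1] (mod 2)"
      "[int (S 2) + 1 = int (S 1) + 0] (mod 2) \<longleftrightarrow> [S 2 = S 1 + 1] (mod 2)"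
      "[int (T 2) + 1 = 1] (mod 2) \<longleftrightarrow> [T 2 = 0] (mod 2)"
      "[int (T 2) + 1 = 0] (mod 2) \<longleftrightarrow> [T 2 = 1] (mod 2)"
      unfolding cong_int_iff[symmetric] by (auto simp: cong_iff_dvd_diff)
    then show ?thesis
      using eqv[of 2 1] eqv[of 2 0] unfolding that e by simp
  qed
  show ?thesis
  proof (intro conjI allI impI)
    assume "p > 2"
    then show "of_nat p ^ 3 dvd (\<Sum>m = p..p ^ 2 - 1. B m) - of_int r * of_nat p ^ 2
        \<longleftrightarrow> of_nat p ^ 2 dvd (\<Sum>m = p..p ^ 2 - 1. b m) - of_int r * of_nat p"
      and "of_nat p ^ 2 dvd (\<Sum>m = p..p ^ 2 - 1. b m) - of_int r * of_nat p
        \<longleftrightarrow> [int (S 2) = int (S 1) + r] (mod int p)"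
      and "[int (S 2) = int (S 1) + r] (mod int p) \<longleftrightarrow> [int (T 2) = r] (mod int p)"
      using main[of 2] by simp_all
  qed (use case_2 main in simp_all)
qed

end
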